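(* Let $m,n\ge1$, $d=m+n$, $\Theta\in\mathbb{R}^{n\times m}$, and weights $\boldsymbol\sigma\in\mathbb{R}^m$, $\boldsymbol\rho\in\mathbb{R}^n$ with $\sigma_1\ge\dots\ge\sigma_m>0$, $\rho_1\ge\dots\ge\rho_n>0$, $\sum\sigma_j=\sum\rho_i=1$. For every $k\in\{1,\dots,d\}$, \[ \omega^{(k)}_{\boldsymbol\sigma,\boldsymbol\rho}(\Theta)\cdot\hat\omega^{(d+1-k)}_{\boldsymbol\rho,\boldsymbol\sigma}({}^t\Theta)=1,\qquad \hat\omega^{(k)}_{\boldsymbol\sigma,\boldsymbol\rho}(\Theta)\cdot\omega^{(d+1-k)}_{\boldsymbol\rho,\boldsymbol\sigma}({}^t\Theta)=1, \] where it is understood that if one of the factors is zero then the other is $+\infty$, and vice versa.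
   Context: For $\mathbf x\in\mathbb{R}^m$, $|\mathbf x|_{\boldsymbol\sigma}=\max_j|x_j|^{1/\sigma_j}$; for $\mathbf y\in\mathbb{R}^n$, $|\mathbf y|_{\boldsymbol\rho}=\max_i|y_i|^{1/\rho_i}$. $\omega^{(k)}_{\boldsymbol\sigma,\boldsymbol\rho}(\Theta)$ (resp. $\hat\omega^{(k)}_{\boldsymbol\sigma,\boldsymbol\rho}(\Theta)$) is the supremum of real $\gamma$ such that the system $|\mathbf x|_{\boldsymbol\sigma}\le t$, $|\Theta\mathbf x-\mathbf y|_{\boldsymbol\rho}\le t^{-\gamma}$ admits $k$ linearly independent solutions $(\mathbf x,\mathbf y)\in\mathbb{Z}^{m+n}$ for some arbitrarily large $t$ (resp. for every $t$ large enough). $\omega^{(k)}_{\boldsymbol\rho,\boldsymbol\sigma}({}^t\Theta)$ (resp. $\hat\omega^{(k)}_{\boldsymbol\rho,\boldsymbol\sigma}({}^t\Theta)$) is the supremum of real $\delta$ such that the system $|\mathbf y|_{\boldsymbol\rho}\le t$, $|{}^t\Theta\mathbf y-\mathbf x|_{\boldsymbol\sigma}\le t^{-\delta}$ admits $k$ linearly independent solutions $(\mathbf x,\mathbf y)\in\mathbb{Z}^{m+n}$ for some arbitrarily large $t$ (resp. for every $t$ large enough). *)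

theory Defs
  imports "HOL-Analysis.Analysis"
begin

definition weighted_norm :: "real ^ 'n \<Rightarrow> real ^ 'n \<Rightarrow> real" where
  "weighted_norm w x = Max (range (\<lambda>i. \<bar>x $ i\<bar> powr (1 / w $ i)))"

definition int_vectors :: "(real ^ 'n) set" where
  "int_vectors = {x. \<forall>i. x $ i \<in> \<int>}"

definition approx_solutions ::
  "real ^ 'm \<Rightarrow> real ^ 'n \<Rightarrow> real ^ 'm ^ 'n \<Rightarrow> real \<Rightarrow> real \<Rightarrow> ((real ^ 'm) \<times> (real ^ 'n)) set" where
  "approx_solutions \<sigma> \<rho> \<Theta> \<gamma> t =
     {(x, y). x \<in> int_vectors \<and> y \<in> int_vectors \<and>
        weighted_norm \<sigma> x \<le> t \<and> weighted_norm \<rho> (\<Theta> *v x - y) \<le> t powr (- \<gamma>)}"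

definition has_independent_solutions ::
  "nat \<Rightarrow> real ^ 'm \<Rightarrow> real ^ 'n \<Rightarrow> real ^ 'm ^ 'n \<Rightarrow> real \<Rightarrow> real \<Rightarrow> bool" where
  "has_independent_solutions k \<sigma> \<rho> \<Theta> \<gamma> t \<longleftrightarrow>
     (\<exists>S. S \<subseteq> approx_solutions \<sigma> \<rho> \<Theta> \<gamma> t \<and> finite S \<and> card S = k \<and> independent S)"

text \<open>The suprema are taken in the extended reals, since the exponents may be infinite.
  The exponents of the transposed system are those of \<^term>\<open>transpose \<Theta>\<close> with the two weights
  exchanged; its solutions are then the pairs \<open>(y, x)\<close> instead of \<open>(x, y)\<close>, which does not
  affect linear independence.\<close>

definition omega_exp :: "nat \<Rightarrow> real ^ 'm \<Rightarrow> real ^ 'n \<Rightarrow> real ^ 'm ^ 'n \<Rightarrow> ereal" where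
  "omega_exp k \<sigma> \<rho> \<Theta> =
     Sup {ereal \<gamma> | \<gamma>. \<exists>\<^sub>F t in at_top. has_independent_solutions k \<sigma> \<rho> \<Theta> \<gamma> t}"

definition omega_hat_exp :: "nat \<Rightarrow> real ^ 'm \<Rightarrow> real ^ 'n \<Rightarrow> real ^ 'm ^ 'n \<Rightarrow> ereal" where
  "omega_hat_exp k \<sigma> \<rho> \<Theta> =
     Sup {ereal \<gamma> | \<gamma>. \<forall>\<^sub>F t in at_top. has_independent_solutions k \<sigma> \<rho> \<Theta> \<gamma> t}"

text \<open>The relation \<open>a \<cdot> b = 1\<close> with the convention that \<open>0\<close> and \<open>+\<infinity>\<close> are reciprocal to each
  other; in \<^typ>\<open>ereal\<close> itself \<open>0 * \<infinity> = 0\<close>.\<close>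

definition product_one :: "ereal \<Rightarrow> ereal \<Rightarrow> bool" where
  "product_one a b \<longleftrightarrow> a * b = 1 \<or> (a = 0 \<and> b = \<infinity>) \<or> (a = \<infinity> \<and> b = 0)"

end

theory Submission
  imports Defs
begin

text \<open>
  After rescaling the coordinates, the systems with parameters \<open>(\<gamma>, t)\<close> and \<open>(1/\<gamma>, t powr \<gamma>)\<close>
  describe the points of a lattice and of its dual lattice in boxes around the origin. Let \<open>p\<close> and
  \<open>q\<close> be the dimensions spanned by these points. If the boxes are small, then all inner products
  between the two sets are integers of absolute value less than \<open>1\<close>, so the sets are orthogonal and
  \<open>p + q \<le> d\<close>. If the boxes are large, then \<open>d \<le> p + q\<close>: every lattice of rank \<open>d\<close> has a basis \<open>b\<close>
  with dual basis \<open>c\<close> such that \<open>norm (b i) * norm (c i) \<le> fact (d + 1)\<close>, hence for each \<open>i\<close> one of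
  \<open>b i\<close> and \<open>c i\<close> is short. Such a basis arises from a shortest vector \<open>s\<close> and a basis of this kind
  for the projection of the lattice orthogonal to \<open>s\<close>, lifted with coefficients of \<open>s\<close> at most \<open>1/2\<close>
  in absolute value. Constant factors are absorbed by changing the exponents slightly.
\<close>

section \<open>Discrete subgroups\<close>

locale add_subgroup =
  fixes L :: "'a::ab_group_add set"
  assumes zero_mem: "0 \<in> L" and diff_mem: "x \<in> L \<Longrightarrow> y \<in> L \<Longrightarrow> x - y \<in> L"
begin

lemma add_mem: "x \<in> L \<Longrightarrow> y \<in> L \<Longrightarrow> x + y \<in> L"
  using diff_mem[OF _ diff_mem[OF zero_mem], of x y] by simp

lemma sum_mem: "(\<And>i. i \<in> I \<Longrightarrow> f i \<in> L) \<Longrightarrow> sum f I \<in> L"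
  by (induction I rule: infinite_finite_induct) (auto intro: zero_mem add_mem)

end

lemma add_subgroup_Ints_scaleR_mem:
  fixes L :: "'a::real_vector set"
  assumes "add_subgroup L" "v \<in> L" "a \<in> \<int>"
  shows "a *\<^sub>R v \<in> L"
proof -
  interpret add_subgroup L by fact
  have "of_int k *\<^sub>R v \<in> L" for k
  proof (induction k rule: int_induct[where k = 0])
    case (step1 i)
    then show ?case using add_mem[OF _ assms(2)] by (simp add: scaleR_add_left)
  next
    case (step2 i)
    then show ?case using diff_mem[OF _ assms(2)] by (simp add: scaleR_diff_left)
  qed (simp add: zero_mem)
  with assms(3) show ?thesis by (metis Ints_cases)
qed

lemma add_subgroup_linear_image:
  assumes "add_subgroup L" "linear f"
  shows "add_subgroup (f ` L)"
proof -
  interpret add_subgroup L by fact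
  show ?thesis
  proof
    show "0 \<in> f ` L" using zero_mem linear_0[OF assms(2)] by (metis imageI)
    show "x - y \<in> f ` L" if "x \<in> f ` L" "y \<in> f ` L" for x y
      using that diff_mem linear_diff[OF assms(2)] by (metis (no_types, lifting) image_iff)
  qed
qed

locale discrete_subgroup = add_subgroup L for L :: "'a::real_normed_vector set" +
  assumes discrete: "uniform_discrete L"
begin

lemma norm_bounded_below:
  obtains e where "0 < e" "\<And>v. v \<in> L \<Longrightarrow> v \<noteq> 0 \<Longrightarrow> e \<le> norm v"
proof -
  obtain e where "0 < e" "\<forall>x\<in>L. \<forall>y\<in>L. dist x y < e \<longrightarrow> x = y"
    using discrete by (auto simp: uniform_discrete_def)
  with zero_mem that show thesis by (metis dist_0_norm linorder_not_less)
qed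

end

lemma discrete_subgroupI:
  assumes "add_subgroup L" "0 < e" "\<And>v. v \<in> L \<Longrightarrow> v \<noteq> 0 \<Longrightarrow> e \<le> norm v"
  shows "discrete_subgroup L"
proof -
  interpret add_subgroup L by fact
  have "x = y" if "x \<in> L" "y \<in> L" "dist x y < e" for x y
    using assms(3)[OF diff_mem[OF that(1,2)]] that(3) by (force simp: dist_norm)
  with assms(2) have "uniform_discrete L" by (auto simp: uniform_discrete_def)
  then show ?thesis by unfold_locales
qed

lemma discrete_subgroup_linear_image:
  fixes f :: "'a::real_normed_vector \<Rightarrow> 'b::euclidean_space"
  assumes "discrete_subgroup L" "linear f" "inj f"
  shows "discrete_subgroup (f ` L)"
proof -
  interpret discrete_subgroup L by fact
  obtain e where "0 < e" and norm_L: "\<And>v. v \<in> L \<Longrightarrow> v \<noteq> 0 \<Longrightarrow> e \<le> norm v"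
    using norm_bounded_below by blast
  obtain B where "0 < B" and norm_f: "\<And>x. B * norm x \<le> norm (f x)"
    using linear_inj_bounded_below_pos assms(2,3) by blast
  show ?thesis
  proof (rule discrete_subgroupI)
    show "add_subgroup (f ` L)"
      using add_subgroup_axioms assms(2) by (rule add_subgroup_linear_image)
    show "0 < B * e" using \<open>0 < B\<close> \<open>0 < e\<close> by simp
    show "B * e \<le> norm w" if "w \<in> f ` L" "w \<noteq> 0" for w
    proof -
      obtain v where "v \<in> L" and w_eq: "w = f v" using \<open>w \<in> f ` L\<close> by blast
      then have "v \<noteq> 0" using \<open>w \<noteq> 0\<close> w_eq linear_0[OF assms(2)] by blast
      then have "B * e \<le> B * norm v" using norm_L \<open>v \<in> L\<close> \<open>0 < B\<close> by simp
      also have "\<dots> \<le> norm w" using norm_f w_eq by simp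
      finally show ?thesis .
    qed
  qed
qed

lemma discrete_subgroup_Times:
  assumes "discrete_subgroup L" "discrete_subgroup M"
  shows "discrete_subgroup (L \<times> M)"
proof -
  interpret L: discrete_subgroup L by fact
  interpret M: discrete_subgroup M by fact
  obtain d where "0 < d" and norm_L: "\<And>v. v \<in> L \<Longrightarrow> v \<noteq> 0 \<Longrightarrow> d \<le> norm v"
    using L.norm_bounded_below by blast
  obtain e where "0 < e" and norm_M: "\<And>v. v \<in> M \<Longrightarrow> v \<noteq> 0 \<Longrightarrow> e \<le> norm v"
    using M.norm_bounded_below by blast
  show ?thesis
  proof (rule discrete_subgroupI)
    show "add_subgroup (L \<times> M)"
      by unfold_locales (auto simp: zero_prod_def L.zero_mem M.zero_mem L.diff_mem M.diff_mem)
    show "0 < min d e" using \<open>0 < d\<close> \<open>0 < e\<close> by simp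
    show "min d e \<le> norm z" if "z \<in> L \<times> M" "z \<noteq> 0" for z
    proof -
      from that have "d \<le> norm (fst z) \<or> e \<le> norm (snd z)"
        using norm_L norm_M by (metis mem_Times_iff prod.collapse zero_prod_def)
      moreover have "norm (fst z) \<le> norm z" "norm (snd z) \<le> norm z"
        using norm_fst_le[of "fst z" "snd z"] norm_snd_le[of "snd z" "fst z"] by simp_all
      ultimately show ?thesis by linarith
    qed
  qed
qed

section \<open>Projection along a shortest vector\<close>

definition proj_coeff :: "'a::real_inner \<Rightarrow> 'a \<Rightarrow> real" where
  "proj_coeff s v = (v \<bullet> s) / (s \<bullet> s)"

definition proj_perp :: "'a::real_inner \<Rightarrow> 'a \<Rightarrow> 'a" where
  "proj_perp s v = v - proj_coeff s v *\<^sub>R s"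

lemma linear_proj_coeff: "linear (proj_coeff s)"
  by (rule linearI) (simp_all add: proj_coeff_def inner_add_left add_divide_distrib)

lemma linear_proj_perp: "linear (proj_perp s)"
  unfolding proj_perp_def
  by (rule linearI) (simp_all add: linear_add linear_cmul linear_proj_coeff algebra_simps)

lemma proj_coeff_self: "s \<noteq> 0 \<Longrightarrow> proj_coeff s s = 1"
  by (simp add: proj_coeff_def)

lemma inner_proj_perp_self: "proj_perp s v \<bullet> s = 0"
  by (cases "s = 0") (simp_all add: proj_perp_def proj_coeff_def inner_diff_left)

lemma norm_proj_decomposition:
  "(norm v)\<^sup>2 = (norm (proj_perp s v))\<^sup>2 + (proj_coeff s v)\<^sup>2 * (norm s)\<^sup>2"
proof -
  have "orthogonal (proj_perp s v) (proj_coeff s v *\<^sub>R s)"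
    by (simp add: orthogonal_def inner_proj_perp_self)
  from norm_add_Pythagorean[OF this] show ?thesis
    by (simp add: proj_perp_def power_mult_distrib)
qed

locale shortest_vector = discrete_subgroup L for L :: "'a::euclidean_space set" +
  fixes s :: 'a
  assumes shortest_mem: "s \<in> L" and shortest_nonzero: "s \<noteq> 0"
    and norm_shortest_le: "v \<in> L \<Longrightarrow> v \<noteq> 0 \<Longrightarrow> norm s \<le> norm v"

lemma ex_shortest_vector:
  fixes L :: "'a::euclidean_space set"
  assumes "discrete_subgroup L" "\<not> L \<subseteq> {0}"
  obtains s where "shortest_vector L s"
proof -
  interpret discrete_subgroup L by fact
  obtain u where u_mem: "u \<in> L" "u \<noteq> 0" using assms(2) by blast
  define F where "F = L \<inter> cball 0 (norm u) - {0}"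
  have "uniform_discrete F"
    using discrete by (rule uniform_discrete_subset) (auto simp: F_def)
  moreover have "bounded F"
    using bounded_cball by (rule bounded_subset) (auto simp: F_def)
  ultimately have "finite F" using uniform_discrete_finite_iff by blast
  moreover have "u \<in> F" using u_mem by (simp add: F_def)
  ultimately obtain s where "s \<in> F" and s_min: "\<And>v. v \<in> F \<Longrightarrow> norm s \<le> norm v"
    using ex_is_arg_min_if_finite[of F norm] by (auto simp: is_arg_min_linorder)
  have "norm s \<le> norm v" if "v \<in> L" "v \<noteq> 0" for v
    using s_min \<open>u \<in> F\<close> that by (cases "norm v \<le> norm u") (force simp: F_def)+
  then have "shortest_vector L s" using \<open>s \<in> F\<close> by unfold_locales (auto simp: F_def)
  then show thesis by (rule that)
qed

context shortest_vector
begin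

lemma Ints_if_scaleR_shortest_mem:
  assumes "a *\<^sub>R s \<in> L"
  shows "a \<in> \<int>"
proof -
  have "a *\<^sub>R s - of_int (round a) *\<^sub>R s \<in> L"
    using assms add_subgroup_Ints_scaleR_mem[OF add_subgroup_axioms shortest_mem]
    by (intro diff_mem) auto
  then have mem: "(a - of_int (round a)) *\<^sub>R s \<in> L" by (simp add: scaleR_diff_left)
  have "\<bar>a - of_int (round a)\<bar> < 1"
    using of_int_round_abs_le[of a] by (simp add: abs_minus_commute)
  then have "norm ((a - of_int (round a)) *\<^sub>R s) < norm s" using shortest_nonzero by simp
  then have "(a - of_int (round a)) *\<^sub>R s = 0" using norm_shortest_le[OF mem] by fastforce
  then have "a = of_int (round a)" using shortest_nonzero by simp
  then show ?thesis by (metis Ints_of_int)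
qed

lemma ex_size_reduced_lift:
  assumes "v \<in> L"
  shows "\<exists>w\<in>L. proj_perp s w = proj_perp s v \<and> \<bar>proj_coeff s w\<bar> \<le> 1/2"
proof
  let ?k = "of_int (round (proj_coeff s v)) :: real"
  have coeff: "proj_coeff s (v - ?k *\<^sub>R s) = proj_coeff s v - ?k"
    by (simp add: linear_diff linear_cmul linear_proj_coeff proj_coeff_self shortest_nonzero)
  have "proj_perp s (v - ?k *\<^sub>R s) = proj_perp s v"
    unfolding proj_perp_def coeff by (simp add: scaleR_diff_left)
  with coeff show "proj_perp s (v - ?k *\<^sub>R s) = proj_perp s v \<and>
      \<bar>proj_coeff s (v - ?k *\<^sub>R s)\<bar> \<le> 1/2"
    using of_int_round_abs_le[of "proj_coeff s v"] by (simp add: abs_minus_commute)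
  show "v - ?k *\<^sub>R s \<in> L"
    using add_subgroup_Ints_scaleR_mem[OF add_subgroup_axioms shortest_mem]
    by (intro diff_mem assms) auto
qed

lemma norm_size_reduced_sq_le:
  assumes "\<bar>proj_coeff s w\<bar> \<le> 1/2"
  shows "(norm w)\<^sup>2 \<le> (norm (proj_perp s w))\<^sup>2 + 1/4 * (norm s)\<^sup>2"
proof -
  have "(proj_coeff s w)\<^sup>2 \<le> 1/4" using power_mono[OF assms, of 2] by (simp add: power_divide)
  then show ?thesis
    using norm_proj_decomposition[of w s] mult_right_mono[of _ "1/4" "(norm s)\<^sup>2"] by simp
qed

lemma norm_shortest_le_proj:
  assumes "w \<in> L" "\<bar>proj_coeff s w\<bar> \<le> 1/2" "proj_perp s w \<noteq> 0"
  shows "norm s \<le> 2 * norm (proj_perp s w)"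
proof -
  have "w \<noteq> 0" using assms(3) linear_0[OF linear_proj_perp] by blast
  then have "(norm s)\<^sup>2 \<le> (norm w)\<^sup>2" using norm_shortest_le assms(1) by (simp add: power_mono)
  also have "\<dots> \<le> (norm (proj_perp s w))\<^sup>2 + 1/4 * (norm s)\<^sup>2"
    using assms(2) by (rule norm_size_reduced_sq_le)
  finally have "(norm s)\<^sup>2 \<le> 4 * (norm (proj_perp s w))\<^sup>2"
    using zero_le_power2[of "norm (proj_perp s w)"] by linarith
  then have "(norm s)\<^sup>2 \<le> (2 * norm (proj_perp s w))\<^sup>2" by (simp add: power_mult_distrib)
  then show ?thesis by (rule power2_le_imp_le) simp
qed

lemma norm_size_reduced_le:
  assumes "w \<in> L" "\<bar>proj_coeff s w\<bar> \<le> 1/2" "proj_perp s w \<noteq> 0"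
  shows "norm w \<le> 2 * norm (proj_perp s w)"
proof -
  have "(norm s)\<^sup>2 \<le> (2 * norm (proj_perp s w))\<^sup>2"
    using norm_shortest_le_proj[OF assms] by (rule power_mono) simp
  then have "(norm w)\<^sup>2 \<le> (2 * norm (proj_perp s w))\<^sup>2"
    using norm_size_reduced_sq_le[OF assms(2)] zero_le_power2[of "norm (proj_perp s w)"]
    unfolding power_mult_distrib power2_eq_square[of 2] by linarith
  then show ?thesis by (rule power2_le_imp_le) simp
qed

lemma discrete_subgroup_proj: "discrete_subgroup (proj_perp s ` L)"
proof (rule discrete_subgroupI)
  show "add_subgroup (proj_perp s ` L)"
    using add_subgroup_axioms linear_proj_perp by (rule add_subgroup_linear_image)
  show "0 < norm s / 2" using shortest_nonzero by simp
  show "norm s / 2 \<le> norm x" if "x \<in> proj_perp s ` L" "x \<noteq> 0" for x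
  proof -
    obtain w where "w \<in> L" "proj_perp s w = x" "\<bar>proj_coeff s w\<bar> \<le> 1/2"
      using \<open>x \<in> proj_perp s ` L\<close> ex_size_reduced_lift by blast
    then show ?thesis using norm_shortest_le_proj \<open>x \<noteq> 0\<close> by fastforce
  qed
qed

lemma span_proj_subset: "span (proj_perp s ` L) \<subseteq> span L"
  by (rule span_minimal)
    (auto simp: proj_perp_def shortest_mem intro!: span_diff span_scale intro: span_base)

lemma inner_shortest_span_proj:
  assumes "x \<in> span (proj_perp s ` L)"
  shows "x \<bullet> s = 0"
  using assms by (induction rule: span_induct_alt) (auto simp: inner_proj_perp_self inner_add_left)

lemma dim_proj_less: "dim (proj_perp s ` L) < dim L"
proof (rule dim_psubset)
  have "s \<notin> span (proj_perp s ` L)" using inner_shortest_span_proj shortest_nonzero by force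
  then show "span (proj_perp s ` L) \<subset> span L"
    using span_proj_subset span_base[OF shortest_mem] by blast
qed

end

section \<open>Reduced bases\<close>

definition dual_lattice :: "'a::real_inner set \<Rightarrow> 'a set" where
  "dual_lattice L = {w \<in> span L. \<forall>v\<in>L. v \<bullet> w \<in> \<int>}"

definition biorthogonal :: "'i set \<Rightarrow> ('i \<Rightarrow> 'a::real_inner) \<Rightarrow> ('i \<Rightarrow> 'a) \<Rightarrow> bool" where
  "biorthogonal I b c \<longleftrightarrow> (\<forall>i\<in>I. \<forall>j\<in>I. b i \<bullet> c j = (if i = j then 1 else 0))"

lemma biorthogonal_commute: "biorthogonal I b c \<longleftrightarrow> biorthogonal I c b"
  by (auto simp: biorthogonal_def inner_commute)

lemma biorthogonal_subset: "biorthogonal I b c \<Longrightarrow> J \<subseteq> I \<Longrightarrow> biorthogonal J b c"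
  unfolding biorthogonal_def by blast

lemma biorthogonal_card_le_dim:
  fixes b c :: "'i \<Rightarrow> 'a::euclidean_space"
  assumes "biorthogonal I b c" "finite I" "b ` I \<subseteq> S"
  shows "card I \<le> dim S"
proof -
  have inner_eq: "b i \<bullet> c j = (if i = j then 1 else 0)" if "i \<in> I" "j \<in> I" for i j
    using assms(1) that by (simp add: biorthogonal_def)
  have inj: "inj_on b I" by (rule inj_onI) (metis inner_eq zero_neq_one)
  have "independent (b ` I)"
  proof (rule independent_if_scalars_zero)
    fix g x assume sum: "(\<Sum>x\<in>b ` I. g x *\<^sub>R x) = 0" and "x \<in> b ` I"
    then obtain j where "j \<in> I" and x_eq: "x = b j" by blast
    have "0 = (\<Sum>i\<in>I. g (b i) *\<^sub>R b i) \<bullet> c j" using sum by (simp add: sum.reindex[OF inj])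
    also have "\<dots> = (\<Sum>i\<in>I. if i = j then g (b i) else 0)"
      unfolding inner_sum_left using inner_eq \<open>j \<in> I\<close> by (intro sum.cong) auto
    also have "\<dots> = g x" using \<open>j \<in> I\<close> x_eq assms(2) by simp
    finally show "g x = 0" by simp
  qed (use assms(2) in simp)
  then show ?thesis
    using independent_card_le_dim[OF assms(3)] by (simp add: card_image[OF inj])
qed

locale lattice_basis =
  fixes L :: "'a::euclidean_space set" and r :: nat and b c :: "nat \<Rightarrow> 'a"
  assumes basis_mem: "i < r \<Longrightarrow> b i \<in> L"
    and dual_mem: "i < r \<Longrightarrow> c i \<in> dual_lattice L"
    and biorthogonal: "biorthogonal {..<r} b c"
    and expansion: "v \<in> L \<Longrightarrow> v = (\<Sum>i<r. (v \<bullet> c i) *\<^sub>R b i)"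
begin

lemma inner_dual: "i < r \<Longrightarrow> j < r \<Longrightarrow> b i \<bullet> c j = (if i = j then 1 else 0)"
  using biorthogonal by (simp add: biorthogonal_def)

lemma dim_eq: "dim L = r"
proof (rule antisym)
  have "L \<subseteq> span (b ` {..<r})"
  proof
    fix v assume "v \<in> L"
    have "(\<Sum>i<r. (v \<bullet> c i) *\<^sub>R b i) \<in> span (b ` {..<r})"
      by (intro span_sum span_scale span_base) auto
    then show "v \<in> span (b ` {..<r})" by (subst expansion[OF \<open>v \<in> L\<close>])
  qed
  then have "dim L \<le> card (b ` {..<r})" by (rule dim_le_card) simp
  also have "\<dots> \<le> r" using card_image_le[of "{..<r}" b] by simp
  finally show "dim L \<le> r" .
  have "card {..<r} \<le> dim L"
    using biorthogonal by (rule biorthogonal_card_le_dim) (auto simp: basis_mem)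
  then show "r \<le> dim L" by simp
qed

end

locale size_reduced_lift =
  shortest_vector L s + proj: lattice_basis "proj_perp s ` L" r "\<lambda>i. proj_perp s (b i)" c
  for L :: "'a::euclidean_space set" and s r b c +
  assumes lift_mem: "i < r \<Longrightarrow> b i \<in> L"
    and size_reduced: "i < r \<Longrightarrow> \<bar>proj_coeff s (b i)\<bar> \<le> 1/2"
begin

text \<open>The only vector of the span with inner product \<open>1\<close> with \<open>s\<close> and \<open>0\<close> with the lifted vectors.\<close>

definition shortest_dual :: 'a where
  "shortest_dual = (1 / (s \<bullet> s)) *\<^sub>R s - (\<Sum>i<r. proj_coeff s (b i) *\<^sub>R c i)"

lemma inner_shortest_dual:
  "v \<bullet> shortest_dual = proj_coeff s v - (\<Sum>i<r. (v \<bullet> c i) * proj_coeff s (b i))"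
  by (simp add: shortest_dual_def inner_diff_right inner_sum_right proj_coeff_def mult.commute)

lemma proj_dual_span: "i < r \<Longrightarrow> c i \<in> span (proj_perp s ` L)"
  using proj.dual_mem by (simp add: dual_lattice_def)

lemma inner_shortest_proj_dual: "i < r \<Longrightarrow> s \<bullet> c i = 0"
  using inner_shortest_span_proj[OF proj_dual_span] by (simp add: inner_commute)

lemma inner_proj_perp_proj_dual: "i < r \<Longrightarrow> proj_perp s v \<bullet> c i = v \<bullet> c i"
  by (simp add: proj_perp_def inner_diff_left inner_shortest_proj_dual)

lemma inner_lift_proj_dual: "i < r \<Longrightarrow> j < r \<Longrightarrow> b i \<bullet> c j = (if i = j then 1 else 0)"
  using proj.inner_dual[of i j] by (simp add: inner_proj_perp_proj_dual)

lemma inner_lift_shortest_dual: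
  assumes "i < r"
  shows "b i \<bullet> shortest_dual = 0"
proof -
  have "(\<Sum>j<r. (b i \<bullet> c j) * proj_coeff s (b j)) =
      (\<Sum>j<r. if i = j then proj_coeff s (b j) else 0)"
    using inner_lift_proj_dual[OF assms] by (intro sum.cong) auto
  then show ?thesis using assms by (simp add: inner_shortest_dual)
qed

lemma inner_shortest_shortest_dual: "s \<bullet> shortest_dual = 1"
  by (simp add: inner_shortest_dual inner_shortest_proj_dual proj_coeff_self shortest_nonzero)

lemma lift_expansion:
  assumes "v \<in> L"
  shows "v = (\<Sum>i<r. (v \<bullet> c i) *\<^sub>R b i) + (v \<bullet> shortest_dual) *\<^sub>R s"
proof -
  have "proj_perp s v = (\<Sum>i<r. (v \<bullet> c i) *\<^sub>R proj_perp s (b i))"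
    using proj.expansion[of "proj_perp s v"] assms by (simp add: inner_proj_perp_proj_dual)
  also have "\<dots> = (\<Sum>i<r. (v \<bullet> c i) *\<^sub>R b i) - (\<Sum>i<r. (v \<bullet> c i) * proj_coeff s (b i)) *\<^sub>R s"
    by (simp add: proj_perp_def scaleR_diff_right sum_subtractf scaleR_sum_left)
  finally show ?thesis unfolding proj_perp_def by (simp add: inner_shortest_dual algebra_simps)
qed

lemma inner_proj_dual_Ints: "v \<in> L \<Longrightarrow> i < r \<Longrightarrow> v \<bullet> c i \<in> \<int>"
  using proj.dual_mem[of i] inner_proj_perp_proj_dual[of i v] by (auto simp: dual_lattice_def)

lemma inner_shortest_dual_Ints:
  assumes "v \<in> L"
  shows "v \<bullet> shortest_dual \<in> \<int>"
proof (rule Ints_if_scaleR_shortest_mem)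
  have "(\<Sum>i<r. (v \<bullet> c i) *\<^sub>R b i) \<in> L"
    using add_subgroup_Ints_scaleR_mem[OF add_subgroup_axioms] lift_mem inner_proj_dual_Ints assms
    by (intro sum_mem) auto
  from diff_mem[OF assms this] show "(v \<bullet> shortest_dual) *\<^sub>R s \<in> L"
    using lift_expansion[OF assms] by (metis add_diff_cancel_left')
qed

lemma lattice_basis_extension: "lattice_basis L (Suc r) (b(r := s)) (c(r := shortest_dual))"
proof
  have span: "c i \<in> span L" if "i < r" for i
    using proj_dual_span[OF that] span_proj_subset by blast
  then have "shortest_dual \<in> span L" unfolding shortest_dual_def
    by (intro span_diff span_scale span_sum) (auto intro: span_base shortest_mem)
  with span show "(c(r := shortest_dual)) i \<in> dual_lattice L" if "i < Suc r" for i
    using that inner_proj_dual_Ints inner_shortest_dual_Ints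
    by (auto simp: dual_lattice_def less_Suc_eq)
  show "(b(r := s)) i \<in> L" if "i < Suc r" for i
    using that lift_mem shortest_mem by (auto simp: less_Suc_eq)
  show "biorthogonal {..<Suc r} (b(r := s)) (c(r := shortest_dual))"
    by (auto simp: biorthogonal_def less_Suc_eq inner_lift_proj_dual inner_lift_shortest_dual
        inner_shortest_proj_dual inner_shortest_shortest_dual)
  show "v = (\<Sum>i<Suc r. (v \<bullet> (c(r := shortest_dual)) i) *\<^sub>R (b(r := s)) i)" if "v \<in> L" for v
    using lift_expansion[OF that] by simp
qed

lemma proj_lift_nonzero: "i < r \<Longrightarrow> proj_perp s (b i) \<noteq> 0"
  using proj.inner_dual[of i i] by auto

lemma norm_shortest_le_proj_lift: "i < r \<Longrightarrow> norm s \<le> 2 * norm (proj_perp s (b i))"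
  by (rule norm_shortest_le_proj[OF lift_mem size_reduced proj_lift_nonzero])

lemma norm_lift_le: "i < r \<Longrightarrow> norm (b i) \<le> 2 * norm (proj_perp s (b i))"
  by (rule norm_size_reduced_le[OF lift_mem size_reduced proj_lift_nonzero])

lemma norm_shortest_mult_shortest_dual_le:
  assumes "\<And>i. i < r \<Longrightarrow> norm (proj_perp s (b i)) * norm (c i) \<le> C"
  shows "norm s * norm shortest_dual \<le> 1 + real r * C"
proof -
  have summand: "norm s * norm (proj_coeff s (b i) *\<^sub>R c i) \<le> C" if "i < r" for i
  proof -
    have "norm s * \<bar>proj_coeff s (b i)\<bar> \<le> (2 * norm (proj_perp s (b i))) * (1/2)"
      using norm_shortest_le_proj_lift[OF that] size_reduced[OF that] by (intro mult_mono) auto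
    then have "norm s * \<bar>proj_coeff s (b i)\<bar> * norm (c i) \<le>
        norm (proj_perp s (b i)) * norm (c i)"
      by (intro mult_right_mono) auto
    also have "\<dots> \<le> C" using assms that by blast
    finally show ?thesis by (simp add: mult.assoc)
  qed
  have "norm shortest_dual \<le>
      norm ((1 / (s \<bullet> s)) *\<^sub>R s) + norm (\<Sum>i<r. proj_coeff s (b i) *\<^sub>R c i)"
    unfolding shortest_dual_def by (rule norm_triangle_ineq4)
  also have "\<dots> \<le> 1 / norm s + (\<Sum>i<r. norm (proj_coeff s (b i) *\<^sub>R c i))"
    by (intro add_mono norm_sum) (simp add: dot_square_norm power2_eq_square)
  finally have "norm s * norm shortest_dual \<le>
      norm s * (1 / norm s + (\<Sum>i<r. norm (proj_coeff s (b i) *\<^sub>R c i)))"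
    by (intro mult_left_mono) auto
  also have "\<dots> = 1 + (\<Sum>i<r. norm s * norm (proj_coeff s (b i) *\<^sub>R c i))"
    using shortest_nonzero by (simp add: distrib_left sum_distrib_left del: norm_scaleR)
  also have "\<dots> \<le> 1 + (\<Sum>i<r. C)" using summand by (intro add_left_mono sum_mono) auto
  finally show ?thesis by simp
qed

text \<open>A bound \<open>C r\<close> for rank \<open>r\<close> passes to rank \<open>Suc r\<close> if \<open>2 * C r\<close> and \<open>1 + r * C r\<close> are at most
  \<open>C (Suc r)\<close>; the choice \<open>C r = fact (Suc r)\<close> meets both requirements.\<close>

lemma norm_extension_le:
  assumes "\<And>i. i < r \<Longrightarrow> norm (proj_perp s (b i)) * norm (c i) \<le> fact (Suc r)" and "i < Suc r"
  shows "norm ((b(r := s)) i) * norm ((c(r := shortest_dual)) i) \<le> fact (Suc (Suc r))"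
proof (cases "i = r")
  case True
  have "norm s * norm shortest_dual \<le> 1 + real r * fact (Suc r)"
    by (rule norm_shortest_mult_shortest_dual_le[OF assms(1)])
  also have "\<dots> \<le> fact (Suc r) + real r * fact (Suc r)" using fact_ge_1 by (intro add_right_mono)
  also have "\<dots> \<le> fact (Suc (Suc r))" by (simp add: algebra_simps)
  finally show ?thesis using True by simp
next
  case False
  then have "i < r" using assms(2) by simp
  have "norm (b i) * norm (c i) \<le> 2 * fact (Suc r)"
    using mult_right_mono[OF norm_lift_le[OF \<open>i < r\<close>] norm_ge_zero[of "c i"]] assms(1)[OF \<open>i < r\<close>]
    by simp
  also have "\<dots> \<le> fact (Suc (Suc r))" by (simp add: algebra_simps)
  finally show ?thesis using False by simp
qed

end

lemma (in shortest_vector) ex_reduced_basis_extension: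
  assumes proj_basis: "lattice_basis (proj_perp s ` L) r b' c"
    and proj_bound: "\<And>i. i < r \<Longrightarrow> norm (b' i) * norm (c i) \<le> fact (Suc r)"
  shows "\<exists>b c. lattice_basis L (Suc r) b c \<and>
    (\<forall>i<Suc r. norm (b i) * norm (c i) \<le> fact (Suc (Suc r)))"
proof -
  have "\<forall>i. \<exists>w. i < r \<longrightarrow> w \<in> L \<and> proj_perp s w = b' i \<and> \<bar>proj_coeff s w\<bar> \<le> 1/2"
    using lattice_basis.basis_mem[OF proj_basis] ex_size_reduced_lift
    by (metis (no_types, lifting) imageE)
  then obtain b where size_reduced: "\<And>i. i < r \<Longrightarrow> b i \<in> L \<and> \<bar>proj_coeff s (b i)\<bar> \<le> 1/2"
    and lift: "\<And>i. i < r \<Longrightarrow> proj_perp s (b i) = b' i"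
    by metis
  have "lattice_basis (proj_perp s ` L) r (\<lambda>i. proj_perp s (b i)) c"
    using proj_basis by (simp add: lattice_basis_def biorthogonal_def lift)
  then interpret size_reduced_lift L s r b c
    using size_reduced shortest_vector_axioms
    by (simp add: size_reduced_lift_def size_reduced_lift_axioms_def)
  have "norm ((b(r := s)) i) * norm ((c(r := shortest_dual)) i) \<le> fact (Suc (Suc r))"
    if "i < Suc r" for i
    using norm_extension_le that proj_bound by (simp add: lift)
  then show ?thesis using lattice_basis_extension by blast
qed

theorem ex_reduced_basis:
  fixes L :: "'a::euclidean_space set"
  assumes "discrete_subgroup L"
  shows "\<exists>b c. lattice_basis L (dim L) b c \<and>
    (\<forall>i<dim L. norm (b i) * norm (c i) \<le> fact (Suc (dim L)))"
  using assms
proof (induction "dim L" arbitrary: L rule: less_induct)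
  case less
  show ?case
  proof (cases "L \<subseteq> {0}")
    case True
    then have "dim L = 0" by simp
    moreover have "lattice_basis L 0 (\<lambda>_. 0) (\<lambda>_. 0)"
      using True by unfold_locales (auto simp: biorthogonal_def)
    ultimately show ?thesis by (metis less_nat_zero_code)
  next
    case False
    then obtain s where "shortest_vector L s" using ex_shortest_vector less.prems by blast
    then interpret shortest_vector L s .
    define r where "r = dim (proj_perp s ` L)"
    obtain b c where extension: "lattice_basis L (Suc r) b c"
      "\<forall>i<Suc r. norm (b i) * norm (c i) \<le> fact (Suc (Suc r))"
      using less.hyps[OF dim_proj_less discrete_subgroup_proj] ex_reduced_basis_extension
      unfolding r_def by blast
    have "dim L = Suc r" using extension(1) by (rule lattice_basis.dim_eq)
    with extension show ?thesis by metis
  qed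
qed

section \<open>Transference\<close>

lemma (in lattice_basis) rank_le_dim_cball_add_dim_dual_lattice_cball:
  assumes "0 < R" and bound: "\<And>i. i < r \<Longrightarrow> norm (b i) * norm (c i) \<le> C"
  shows "r \<le> dim (L \<inter> cball 0 R) + dim (dual_lattice L \<inter> cball 0 (C / R))"
proof -
  define I where "I = {i. i < r \<and> norm (b i) \<le> R}"
  define J where "J = {i. i < r \<and> R < norm (b i)}"
  have finite: "finite I" "finite J" by (auto simp: I_def J_def)
  have "card I \<le> dim (L \<inter> cball 0 R)"
  proof (rule biorthogonal_card_le_dim[OF _ finite(1)])
    show "biorthogonal I b c" using biorthogonal by (rule biorthogonal_subset) (auto simp: I_def)
    show "b ` I \<subseteq> L \<inter> cball 0 R" using basis_mem by (auto simp: I_def)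
  qed
  moreover have "card J \<le> dim (dual_lattice L \<inter> cball 0 (C / R))"
  proof (rule biorthogonal_card_le_dim[OF _ finite(2)])
    show "biorthogonal J c b" using biorthogonal
      unfolding biorthogonal_commute[of _ b] by (rule biorthogonal_subset) (auto simp: J_def)
    have "norm (c i) \<le> C / R" if "i \<in> J" for i
    proof -
      have "R * norm (c i) \<le> norm (b i) * norm (c i)"
        using that by (intro mult_right_mono) (auto simp: J_def)
      also have "\<dots> \<le> C" using that bound by (simp add: J_def)
      finally show ?thesis using \<open>0 < R\<close> by (simp add: pos_le_divide_eq mult.commute)
    qed
    then show "c ` J \<subseteq> dual_lattice L \<inter> cball 0 (C / R)" using dual_mem by (auto simp: J_def)
  qed
  moreover have "card I + card J = r"
  proof -
    have "I \<union> J = {..<r}" "I \<inter> J = {}" by (auto simp: I_def J_def)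
    then show ?thesis using finite by (metis card_Un_disjoint card_lessThan)
  qed
  ultimately show ?thesis by linarith
qed

theorem dim_le_dim_cball_add_dim_dual_lattice_cball:
  fixes L :: "'a::euclidean_space set"
  assumes "discrete_subgroup L" "0 < R"
  shows "dim L \<le> dim (L \<inter> cball 0 R) + dim (dual_lattice L \<inter> cball 0 (fact (Suc (dim L)) / R))"
  using ex_reduced_basis[OF assms(1)] assms(2)
    lattice_basis.rank_le_dim_cball_add_dim_dual_lattice_cball
  by blast

section \<open>The lattice of a system of linear forms\<close>

definition box_solutions ::
  "real ^ 'm \<Rightarrow> real ^ 'n \<Rightarrow> real ^ 'm ^ 'n \<Rightarrow> ((real ^ 'm) \<times> (real ^ 'n)) set" where
  "box_solutions a q \<Theta> = {(x, y). x \<in> int_vectors \<and> y \<in> int_vectors \<and>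
     (\<forall>j. \<bar>x $ j\<bar> \<le> a $ j) \<and> (\<forall>i. \<bar>(\<Theta> *v x - y) $ i\<bar> \<le> q $ i)}"

definition scaled_forms ::
  "real ^ 'm \<Rightarrow> real ^ 'n \<Rightarrow> real ^ 'm ^ 'n \<Rightarrow>
    (real ^ 'm) \<times> (real ^ 'n) \<Rightarrow> (real ^ 'm) \<times> (real ^ 'n)" where
  "scaled_forms a q \<Theta> = (\<lambda>(x, y). (\<chi> j. x $ j / a $ j, \<chi> i. (\<Theta> *v x - y) $ i / q $ i))"

text \<open>The alternating form \<open>z \<bullet> quarter_turn z'\<close> is preserved up to sign by applying
  \<^const>\<open>scaled_forms\<close> to \<open>z\<close> and its counterpart for the transposed system to \<open>z'\<close>. This is why
  the dual of the lattice of a system is the rotated lattice of the transposed system.\<close>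

definition quarter_turn :: "'a \<times> 'b \<Rightarrow> 'b \<times> 'a::uminus" where
  "quarter_turn = (\<lambda>(u, v). (v, - u))"

definition vec_inverse :: "real ^ 'n \<Rightarrow> real ^ 'n" where
  "vec_inverse a = (\<chi> i. inverse (a $ i))"

lemma box_solutions_mono:
  assumes "\<And>j. a $ j \<le> a' $ j" "\<And>i. q $ i \<le> q' $ i"
  shows "box_solutions a q \<Theta> \<subseteq> box_solutions a' q' \<Theta>"
  unfolding box_solutions_def
  by (auto intro: order_trans[OF _ assms(1)] order_trans[OF _ assms(2)])

lemma linear_scaled_forms: "linear (scaled_forms a q \<Theta>)"
  by (rule linearI) (simp_all add: scaled_forms_def case_prod_beta vec_eq_iff
      matrix_vector_right_distrib matrix_vector_mult_scaleR add_divide_distrib diff_divide_distrib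
      right_diff_distrib)

lemma inj_scaled_forms:
  assumes "\<And>j. a $ j \<noteq> 0" "\<And>i. q $ i \<noteq> 0"
  shows "inj (scaled_forms a q \<Theta>)"
proof (rule injI)
  fix z z' assume eq: "scaled_forms a q \<Theta> z = scaled_forms a q \<Theta> z'"
  then have "fst z = fst z'"
    using assms(1) by (simp add: scaled_forms_def case_prod_beta vec_eq_iff)
  moreover have "\<Theta> *v fst z - snd z = \<Theta> *v fst z' - snd z'"
    using eq assms(2) by (simp add: scaled_forms_def case_prod_beta vec_eq_iff)
  ultimately show "z = z'" by (simp add: prod_eq_iff)
qed

lemma mem_box_solutions_if_norm_scaled_forms_le:
  assumes "z \<in> int_vectors \<times> int_vectors" "norm (scaled_forms a q \<Theta> z) \<le> C"
    and "\<And>j. 0 < a $ j" "\<And>i. 0 < q $ i"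
  shows "z \<in> box_solutions (C *\<^sub>R a) (C *\<^sub>R q) \<Theta>"
proof -
  obtain x y where z_eq: "z = (x, y)" by force
  have norms: "norm (\<chi> j. x $ j / a $ j) \<le> C" "norm (\<chi> i. (\<Theta> *v x - y) $ i / q $ i) \<le> C"
    using assms(2) norm_fst_le norm_snd_le unfolding scaled_forms_def z_eq prod.case
    by (blast intro: order_trans)+
  have "\<bar>x $ j\<bar> \<le> C * a $ j" for j
    using order_trans[OF component_le_norm_cart norms(1), of j] assms(3)[of j]
    by (simp add: pos_divide_le_eq)
  moreover have "\<bar>(\<Theta> *v x - y) $ i\<bar> \<le> C * q $ i" for i
    using order_trans[OF component_le_norm_cart norms(2), of i] assms(4)[of i]
    by (simp add: pos_divide_le_eq)
  ultimately show ?thesis using assms(1) by (simp add: box_solutions_def z_eq)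
qed

lemma linear_quarter_turn: "linear (quarter_turn :: 'a::real_vector \<times> 'b::real_vector \<Rightarrow> 'b \<times> 'a)"
  by (auto simp: quarter_turn_def linear_iff)

lemma inj_quarter_turn: "inj (quarter_turn :: 'a::ab_group_add \<times> 'b \<Rightarrow> 'b \<times> 'a)"
  by (auto simp: quarter_turn_def inj_def)

lemma norm_quarter_turn:
  fixes z :: "'a::real_normed_vector \<times> 'b::real_normed_vector"
  shows "norm (quarter_turn z) = norm z"
  by (simp add: quarter_turn_def case_prod_beta norm_prod_def add.commute)

lemma inner_quarter_turn_eq:
  fixes \<Theta> :: "real ^ 'm ^ 'n"
  shows "(x, y) \<bullet> quarter_turn (y', x') = (\<Theta> *v x - y) \<bullet> y' - x \<bullet> (transpose \<Theta> *v y' - x')"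
proof -
  have "(\<Theta> *v x) \<bullet> y' = x \<bullet> (transpose \<Theta> *v y')"
    by (simp add: dot_lmul_matrix inner_commute[of x] inner_commute[of _ y'])
  then show ?thesis
    by (simp add: quarter_turn_def inner_diff_left inner_diff_right del: transpose_matrix_vector)
qed

lemma inner_scaled_forms:
  fixes \<Theta> :: "real ^ 'm ^ 'n"
  assumes "\<And>j. a $ j \<noteq> 0" "\<And>i. q $ i \<noteq> 0"
  shows "scaled_forms a q \<Theta> z \<bullet>
      quarter_turn (scaled_forms (vec_inverse q) (vec_inverse a) (transpose \<Theta>) z') =
    - (z \<bullet> quarter_turn z')"
proof -
  obtain x y where z_eq: "z = (x, y)" by force
  obtain y' x' where z'_eq: "z' = (y', x')" by force
  show ?thesis
    unfolding z_eq z'_eq inner_quarter_turn_eq[of x y y' x' \<Theta>] using assms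
    by (simp add: scaled_forms_def quarter_turn_def vec_inverse_def inner_vec_def sum_negf
        del: transpose_matrix_vector)
qed

lemma inner_int_vectors: "x \<in> int_vectors \<Longrightarrow> y \<in> int_vectors \<Longrightarrow> x \<bullet> y \<in> \<int>"
  by (auto simp: int_vectors_def inner_vec_def intro!: Ints_mult)

lemma axis_mem_int_vectors [simp]: "axis i 1 \<in> int_vectors"
  by (simp add: int_vectors_def axis_def)

lemma zero_mem_int_vectors [simp]: "0 \<in> int_vectors"
  by (simp add: int_vectors_def)

lemma inner_quarter_turn_Ints:
  assumes "z \<in> int_vectors \<times> int_vectors" "z' \<in> int_vectors \<times> int_vectors"
  shows "z \<bullet> quarter_turn z' \<in> \<int>"
  using assms by (auto simp: quarter_turn_def intro!: Ints_diff inner_int_vectors)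

lemma int_vectors_Times_if_inner_quarter_turn_Ints:
  fixes z' :: "(real ^ 'n) \<times> (real ^ 'm)"
  assumes "\<And>z. z \<in> int_vectors \<times> int_vectors \<Longrightarrow> z \<bullet> quarter_turn z' \<in> \<int>"
  shows "z' \<in> int_vectors \<times> int_vectors"
proof -
  have "snd z' $ j \<in> \<int>" for j
    using assms[of "(axis j 1, 0)"] by (simp add: quarter_turn_def case_prod_beta inner_axis')
  moreover have "fst z' $ i \<in> \<int>" for i
    using assms[of "(0, axis i 1)"] by (simp add: quarter_turn_def case_prod_beta inner_axis')
  ultimately show ?thesis by (simp add: mem_Times_iff int_vectors_def)
qed

lemma discrete_subgroup_int_vectors: "discrete_subgroup (int_vectors :: (real ^ 'n) set)"
proof (rule discrete_subgroupI)
  show "add_subgroup (int_vectors :: (real ^ 'n) set)"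
    by unfold_locales (auto simp: int_vectors_def)
  show "1 \<le> norm x" if "x \<in> int_vectors" "x \<noteq> 0" for x :: "real ^ 'n"
  proof -
    obtain i where "x $ i \<noteq> 0" using \<open>x \<noteq> 0\<close> by (auto simp: vec_eq_iff)
    then have "1 \<le> \<bar>x $ i\<bar>"
      using that(1) by (intro Ints_nonzero_abs_ge1) (auto simp: int_vectors_def)
    also have "\<dots> \<le> norm x" by (rule component_le_norm_cart)
    finally show ?thesis .
  qed
qed simp

lemma Basis_subset_int_vectors_Times:
  "(Basis :: ((real ^ 'm) \<times> (real ^ 'n)) set) \<subseteq> int_vectors \<times> int_vectors"
  by (auto simp: Basis_prod_def Basis_vec_def)

lemma dim_int_vectors_Times:
  "dim (int_vectors \<times> int_vectors :: ((real ^ 'm) \<times> (real ^ 'n)) set) = CARD('m) + CARD('n)"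
proof (rule antisym)
  show "dim (int_vectors \<times> int_vectors :: ((real ^ 'm) \<times> (real ^ 'n)) set) \<le>
      CARD('m) + CARD('n)"
    using dim_subset_UNIV by (metis DIM_cart DIM_prod DIM_real mult.right_neutral)
  show "CARD('m) + CARD('n) \<le>
      dim (int_vectors \<times> int_vectors :: ((real ^ 'm) \<times> (real ^ 'n)) set)"
    using independent_card_le_dim[OF Basis_subset_int_vectors_Times independent_Basis] by simp
qed

definition form_lattice ::
  "real ^ 'm \<Rightarrow> real ^ 'n \<Rightarrow> real ^ 'm ^ 'n \<Rightarrow> ((real ^ 'm) \<times> (real ^ 'n)) set" where
  "form_lattice a q \<Theta> = scaled_forms a q \<Theta> ` (int_vectors \<times> int_vectors)"

lemma discrete_subgroup_form_lattice:
  assumes "\<And>j. a $ j \<noteq> 0" "\<And>i. q $ i \<noteq> 0"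
  shows "discrete_subgroup (form_lattice a q \<Theta>)"
  unfolding form_lattice_def
  by (intro discrete_subgroup_linear_image discrete_subgroup_Times discrete_subgroup_int_vectors
      linear_scaled_forms inj_scaled_forms assms)

lemma dim_form_lattice:
  fixes \<Theta> :: "real ^ 'm ^ 'n"
  assumes "\<And>j. a $ j \<noteq> 0" "\<And>i. q $ i \<noteq> 0"
  shows "dim (form_lattice a q \<Theta>) = CARD('m) + CARD('n)"
proof -
  have "inj (scaled_forms a q \<Theta>)" using assms by (rule inj_scaled_forms)
  then have "dim (form_lattice a q \<Theta>) =
      dim (int_vectors \<times> int_vectors :: ((real ^ 'm) \<times> (real ^ 'n)) set)"
    unfolding form_lattice_def
    by (intro dim_image_eq linear_scaled_forms) (auto intro: inj_on_subset)
  then show ?thesis by (simp only: dim_int_vectors_Times)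
qed

lemma dim_form_lattice_cball_le:
  assumes "\<And>j. 0 < a $ j" "\<And>i. 0 < q $ i"
  shows "dim (form_lattice a q \<Theta> \<inter> cball 0 C) \<le> dim (box_solutions (C *\<^sub>R a) (C *\<^sub>R q) \<Theta>)"
proof -
  have "form_lattice a q \<Theta> \<inter> cball 0 C \<subseteq>
      scaled_forms a q \<Theta> ` box_solutions (C *\<^sub>R a) (C *\<^sub>R q) \<Theta>"
    unfolding form_lattice_def
    by (auto intro!: imageI mem_box_solutions_if_norm_scaled_forms_le assms simp del: mem_Sigma_iff)
  from dim_subset[OF this] dim_image_le[OF linear_scaled_forms] show ?thesis
    by (rule order_trans)
qed

lemma dual_form_lattice_subset:
  fixes \<Theta> :: "real ^ 'm ^ 'n"
  assumes "\<And>j. a $ j \<noteq> 0" "\<And>i. q $ i \<noteq> 0"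
  shows "dual_lattice (form_lattice a q \<Theta>) \<subseteq>
    quarter_turn ` form_lattice (vec_inverse q) (vec_inverse a) (transpose \<Theta>)"
proof
  define T where "T = scaled_forms (vec_inverse q) (vec_inverse a) (transpose \<Theta>)"
  fix w assume w_dual: "w \<in> dual_lattice (form_lattice a q \<Theta>)"
  have "vec_inverse q $ i \<noteq> 0" "vec_inverse a $ j \<noteq> 0" for i j
    using assms by (simp_all add: vec_inverse_def)
  then have "inj (quarter_turn \<circ> T)"
    unfolding T_def by (intro inj_compose inj_quarter_turn inj_scaled_forms)
  moreover have "linear (quarter_turn \<circ> T)"
    unfolding T_def by (intro linear_compose linear_quarter_turn linear_scaled_forms)
  ultimately have "surj (quarter_turn \<circ> T)" by (intro linear_injective_imp_surjective) simp_all
  then obtain z' where w_eq: "w = quarter_turn (T z')" by (metis comp_apply surjD)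
  have "z \<bullet> quarter_turn z' \<in> \<int>" if "z \<in> int_vectors \<times> int_vectors" for z
  proof -
    have "scaled_forms a q \<Theta> z \<bullet> w \<in> \<int>"
      using w_dual that by (force simp: dual_lattice_def form_lattice_def)
    then show ?thesis using inner_scaled_forms[OF assms, of \<Theta> z z'] by (simp add: w_eq T_def)
  qed
  then have "z' \<in> int_vectors \<times> int_vectors"
    by (rule int_vectors_Times_if_inner_quarter_turn_Ints)
  with w_eq show "w \<in> quarter_turn ` form_lattice (vec_inverse q) (vec_inverse a) (transpose \<Theta>)"
    unfolding form_lattice_def T_def by blast
qed

section \<open>Dimensions of dual boxes\<close>

theorem dim_box_solutions_transference:
  fixes \<Theta> :: "real ^ 'm ^ 'n"
  defines "C \<equiv> fact (CARD('m) + CARD('n) + 1)"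
  assumes pos: "\<And>j. 0 < a $ j" "\<And>i. 0 < q $ i"
  shows "CARD('m) + CARD('n) \<le> dim (box_solutions a q \<Theta>) +
    dim (box_solutions (C *\<^sub>R vec_inverse q) (C *\<^sub>R vec_inverse a) (transpose \<Theta>))"
proof -
  define M where "M = form_lattice (vec_inverse q) (vec_inverse a) (transpose \<Theta>)"
  have nonzero: "a $ j \<noteq> 0" "q $ i \<noteq> 0" for i j
    using pos by (simp_all add: less_imp_neq[symmetric])
  have "dual_lattice (form_lattice a q \<Theta>) \<inter> cball 0 C \<subseteq> quarter_turn ` (M \<inter> cball 0 C)"
    using dual_form_lattice_subset[OF nonzero, of \<Theta>] by (auto simp: M_def norm_quarter_turn)
  then have "dim (dual_lattice (form_lattice a q \<Theta>) \<inter> cball 0 C) \<le> dim (M \<inter> cball 0 C)"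
    using dim_subset dim_image_le[OF linear_quarter_turn] order_trans by blast
  also have "\<dots> \<le> dim (box_solutions (C *\<^sub>R vec_inverse q) (C *\<^sub>R vec_inverse a) (transpose \<Theta>))"
    unfolding M_def using pos by (intro dim_form_lattice_cball_le) (simp_all add: vec_inverse_def)
  finally show ?thesis
    using dim_le_dim_cball_add_dim_dual_lattice_cball[of "form_lattice a q \<Theta>" 1]
      discrete_subgroup_form_lattice[OF nonzero]
      dim_form_lattice_cball_le[OF pos, where C = 1 and \<Theta> = \<Theta>]
    by (simp add: dim_form_lattice[OF nonzero] C_def)
qed

lemma abs_inner_le:
  fixes x y a b :: "real ^ 'n"
  assumes "\<And>i. \<bar>x $ i\<bar> \<le> a $ i" "\<And>i. \<bar>y $ i\<bar> \<le> b $ i"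
  shows "\<bar>x \<bullet> y\<bar> \<le> a \<bullet> b"
  unfolding inner_vec_def
proof (rule order_trans[OF sum_abs], rule sum_mono)
  fix i
  have "0 \<le> a $ i" using assms(1)[of i] by linarith
  then show "\<bar>x $ i \<bullet> y $ i\<bar> \<le> a $ i \<bullet> b $ i" using assms by (simp add: abs_mult mult_mono)
qed

lemma dim_add_dim_le_if_orthogonal:
  fixes S T :: "'a::euclidean_space set"
  assumes "\<And>x y. x \<in> S \<Longrightarrow> y \<in> T \<Longrightarrow> x \<bullet> y = 0"
  shows "dim S + dim T \<le> DIM('a)"
  using dim_orthogonal_sum[OF assms] dim_subset_UNIV[of "S \<union> T"] by simp

theorem dim_box_solutions_obstruction:
  fixes \<Theta> :: "real ^ 'm ^ 'n"
  assumes "a \<bullet> q' + q \<bullet> a' < 1"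
  shows "dim (box_solutions a q \<Theta>) + dim (box_solutions a' q' (transpose \<Theta>)) \<le>
    CARD('m) + CARD('n)"
proof -
  define B where "B = box_solutions a q \<Theta>"
  define B' where "B' = box_solutions a' q' (transpose \<Theta>)"
  have "z \<bullet> quarter_turn z' = 0" if "z \<in> B" "z' \<in> B'" for z z'
  proof -
    obtain x y where z_eq: "z = (x, y)" by force
    obtain y' x' where z'_eq: "z' = (y', x')" by force
    have "\<bar>(\<Theta> *v x - y) \<bullet> y'\<bar> \<le> q \<bullet> a'" "\<bar>x \<bullet> (transpose \<Theta> *v y' - x')\<bar> \<le> a \<bullet> q'"
      using that by (auto simp: B_def B'_def z_eq z'_eq box_solutions_def intro!: abs_inner_le)
    then have "\<bar>z \<bullet> quarter_turn z'\<bar> < 1"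
      unfolding z_eq z'_eq inner_quarter_turn_eq[of x y y' x' \<Theta>] using assms by linarith
    moreover have "z \<bullet> quarter_turn z' \<in> \<int>"
      using that by (intro inner_quarter_turn_Ints) (auto simp: B_def B'_def box_solutions_def)
    ultimately show ?thesis using Ints_nonzero_abs_less1 by blast
  qed
  then have "dim B + dim (quarter_turn ` B') \<le> DIM((real ^ 'm) \<times> (real ^ 'n))"
    by (intro dim_add_dim_le_if_orthogonal) auto
  moreover have "dim (quarter_turn ` B') = dim B'"
    using linear_quarter_turn inj_on_subset[OF inj_quarter_turn] by (intro dim_image_eq) auto
  ultimately show ?thesis by (simp add: B_def B'_def)
qed

section \<open>Weighted norms\<close>

definition box_radii :: "real ^ 'n \<Rightarrow> real \<Rightarrow> real ^ 'n" where
  "box_radii w t = (\<chi> i. t powr (w $ i))"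

lemma powr_inverse_le_iff:
  fixes u t w :: real
  assumes "0 \<le> u" "0 < t" "0 < w"
  shows "u powr (1 / w) \<le> t \<longleftrightarrow> u \<le> t powr w"
proof
  assume "u powr (1 / w) \<le> t"
  then have "(u powr (1 / w)) powr w \<le> t powr w" using assms by (intro powr_mono2) auto
  then show "u \<le> t powr w" using assms by (simp add: powr_powr)
next
  assume "u \<le> t powr w"
  then have "u powr (1 / w) \<le> (t powr w) powr (1 / w)" using assms by (intro powr_mono2) auto
  then show "u powr (1 / w) \<le> t" using assms by (simp add: powr_powr)
qed

lemma weighted_norm_le_iff:
  fixes w x :: "real ^ 'n"
  assumes "\<And>i. 0 < w $ i" "0 < t"
  shows "weighted_norm w x \<le> t \<longleftrightarrow> (\<forall>i. \<bar>x $ i\<bar> \<le> box_radii w t $ i)"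
proof -
  have "weighted_norm w x \<le> t \<longleftrightarrow> (\<forall>i. \<bar>x $ i\<bar> powr (1 / w $ i) \<le> t)"
    by (simp add: weighted_norm_def)
  then show ?thesis
    using powr_inverse_le_iff[OF abs_ge_zero assms(2) assms(1)] by (simp add: box_radii_def)
qed

lemma approx_solutions_eq_box_solutions:
  assumes "\<And>j. 0 < \<sigma> $ j" "\<And>i. 0 < \<rho> $ i" "0 < t"
  shows "approx_solutions \<sigma> \<rho> \<Theta> \<gamma> t = box_solutions (box_radii \<sigma> t) (box_radii \<rho> (t powr - \<gamma>)) \<Theta>"
  using assms unfolding approx_solutions_def box_solutions_def by (simp add: weighted_norm_le_iff)

lemma vec_inverse_box_radii: "vec_inverse (box_radii w t) = box_radii w (inverse t)"
  by (simp add: vec_inverse_def box_radii_def vec_eq_iff inverse_powr)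

lemma filterlim_powr_at_top:
  fixes p :: real
  assumes "0 < p"
  shows "filterlim (\<lambda>t. t powr p) at_top at_top"
proof (rule filterlim_cong[THEN iffD1, OF refl refl])
  show "filterlim (\<lambda>t. exp (p * ln t)) at_top at_top"
    using assms ln_at_top
    by (intro filterlim_compose[OF exp_at_top] filterlim_tendsto_pos_mult_at_top[OF tendsto_const])
  show "\<forall>\<^sub>F t in at_top. exp (p * ln t) = t powr p"
    using eventually_gt_at_top[of 0] by eventually_elim (simp add: powr_def)
qed

lemma eventually_le_powr:
  fixes p :: real
  assumes "0 < p"
  shows "\<forall>\<^sub>F t in at_top. C \<le> t powr p"
  using filterlim_powr_at_top[OF assms] by (simp add: filterlim_at_top)

lemma eventually_powr_at_top_iff:
  fixes p :: real
  assumes "0 < p"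
  shows "(\<forall>\<^sub>F t in at_top. P (t powr p)) \<longleftrightarrow> (\<forall>\<^sub>F t in at_top. P t)"
proof -
  have "filtermap (\<lambda>t. t powr p) at_top = at_top"
  proof (rule filtermap_fun_inverse[of "\<lambda>s. s powr (1 / p)"])
    show "\<forall>\<^sub>F t::real in at_top. (t powr (1 / p)) powr p = t"
      using eventually_gt_at_top[of 0] by eventually_elim (use assms in \<open>simp add: powr_powr\<close>)
  qed (use assms in \<open>simp_all add: filterlim_powr_at_top\<close>)
  then show ?thesis by (metis eventually_filtermap)
qed

lemma eventually_scaleR_box_radii_le:
  assumes "\<And>i. 0 < w $ i" "p < p'"
  shows "\<forall>\<^sub>F t in at_top. \<forall>i. (C *\<^sub>R box_radii w (t powr p)) $ i \<le> box_radii w (t powr p') $ i"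
proof -
  have "\<forall>\<^sub>F t in at_top. \<forall>i. C \<le> t powr ((p' - p) * w $ i)"
    using assms by (intro eventually_all_finite eventually_le_powr) simp
  then show ?thesis
  proof eventually_elim
    case (elim t)
    have "C * t powr (p * w $ i) \<le> t powr (p' * w $ i)" for i
    proof -
      have "C * t powr (p * w $ i) \<le> t powr ((p' - p) * w $ i) * t powr (p * w $ i)"
        using elim by (intro mult_right_mono) auto
      also have "\<dots> = t powr (p' * w $ i)" by (simp add: algebra_simps flip: powr_add)
      finally show ?thesis .
    qed
    then show ?case by (simp add: box_radii_def powr_powr)
  qed
qed

lemma tendsto_inner_box_radii_0:
  fixes w :: "real ^ 'n"
  assumes "\<And>i. 0 < w $ i" "p + p' < 0"
  shows "((\<lambda>t. box_radii w (t powr p) \<bullet> box_radii w (t powr p')) \<longlongrightarrow> 0) at_top"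
proof -
  have "((\<lambda>t. \<Sum>i\<in>UNIV. t powr ((p + p') * w $ i)) \<longlongrightarrow> (\<Sum>i\<in>(UNIV :: 'n set). 0)) at_top"
    using assms by (intro tendsto_sum tendsto_neg_powr filterlim_ident) (simp add: mult_neg_pos)
  then show ?thesis
    by (simp add: inner_vec_def box_radii_def powr_powr distrib_right powr_add)
qed

section \<open>Reciprocal suprema\<close>

lemma product_one_commute: "product_one a b \<longleftrightarrow> product_one b a"
  by (auto simp: product_one_def mult.commute)

lemma product_one_inverse: "0 \<le> a \<Longrightarrow> product_one a (inverse a)"
  by (cases a) (auto simp: product_one_def one_ereal_def)

lemma Sup_ereal_image_nonneg:
  assumes "\<And>x. x < 0 \<Longrightarrow> x \<in> X"
  shows "0 \<le> Sup (ereal ` X)"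
proof (rule dense_le)
  fix y :: ereal assume "y < 0"
  with assms show "y \<le> Sup (ereal ` X)" by (cases y) (auto intro: Sup_upper)
qed

lemma Sup_ereal_le_inverse_Sup_ereal:
  fixes A B :: "real set"
  assumes nonneg: "0 \<le> Sup (ereal ` A)"
    and mult_le: "\<And>x y. x \<in> A \<Longrightarrow> y \<in> B \<Longrightarrow> 0 < x \<Longrightarrow> 0 < y \<Longrightarrow> x * y \<le> 1"
  shows "Sup (ereal ` B) \<le> inverse (Sup (ereal ` A))"
proof (rule Sup_least, clarify)
  fix y assume "y \<in> B"
  show "ereal y \<le> inverse (Sup (ereal ` A))"
  proof (cases "0 < y")
    case True
    have "x \<le> inverse y" if "x \<in> A" for x
    proof (cases "0 < x")
      case True
      then show ?thesis
        using mult_le[OF that \<open>y \<in> B\<close> True \<open>0 < y\<close>] \<open>0 < y\<close> by (simp add: field_simps)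
    next
      case False
      then have "x \<le> 0" by simp
      also have "0 \<le> inverse y" using \<open>0 < y\<close> by simp
      finally show ?thesis .
    qed
    then have "Sup (ereal ` A) \<le> ereal (inverse y)" by (auto intro: Sup_least)
    from ereal_inverse_antimono[OF nonneg this] show ?thesis using True by simp
  next
    case False
    then have "ereal y \<le> 0" by simp
    also have "0 \<le> inverse (Sup (ereal ` A))" using nonneg by (cases "Sup (ereal ` A)") auto
    finally show ?thesis .
  qed
qed

lemma inverse_Sup_ereal_le_Sup_ereal:
  fixes A B :: "real set"
  assumes nonneg: "0 \<le> Sup (ereal ` A)" "0 \<le> Sup (ereal ` B)"
    and mem: "\<And>x y. 0 < x \<Longrightarrow> 0 < y \<Longrightarrow> x * y < 1 \<Longrightarrow> x \<in> A \<or> y \<in> B"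
  shows "inverse (Sup (ereal ` A)) \<le> Sup (ereal ` B)"
proof (rule dense_le)
  define a where "a = Sup (ereal ` A)"
  fix y assume y_less: "y < inverse (Sup (ereal ` A))"
  show "y \<le> Sup (ereal ` B)"
  proof (cases "0 < y")
    case True
    with y_less obtain v where y_eq: "y = ereal v" and "0 < v" by (cases y) auto
    have "\<not> ereal (inverse v) \<le> a"
      using ereal_inverse_antimono[of "ereal (inverse v)" a] y_less y_eq \<open>0 < v\<close>
      by (auto simp: a_def)
    then obtain x where x_between: "a < ereal x" "x < inverse v"
      using ereal_dense2[of a "ereal (inverse v)"] by (auto simp: not_le)
    have "0 < x" using x_between(1) nonneg(1) by (metis a_def ereal_less(2) order_le_less_trans)
    moreover have "x \<notin> A" using x_between(1) unfolding a_def by (meson Sup_upper imageI not_less)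
    moreover have "x * v < 1" using x_between(2) \<open>0 < v\<close> by (simp add: field_simps)
    ultimately have "v \<in> B" using mem \<open>0 < v\<close> by blast
    then show ?thesis unfolding y_eq by (auto intro: Sup_upper)
  next
    case False
    then show ?thesis using nonneg(2) by (meson not_less order_trans)
  qed
qed

lemma product_one_Sup:
  fixes A B :: "real set"
  assumes neg: "\<And>x. x < 0 \<Longrightarrow> x \<in> A" "\<And>x. x < 0 \<Longrightarrow> x \<in> B"
    and mult_le: "\<And>x y. x \<in> A \<Longrightarrow> y \<in> B \<Longrightarrow> 0 < x \<Longrightarrow> 0 < y \<Longrightarrow> x * y \<le> 1"
    and mem: "\<And>x y. 0 < x \<Longrightarrow> 0 < y \<Longrightarrow> x * y < 1 \<Longrightarrow> x \<in> A \<or> y \<in> B"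
  shows "product_one (Sup (ereal ` A)) (Sup (ereal ` B))"
proof -
  have nonneg: "0 \<le> Sup (ereal ` A)" "0 \<le> Sup (ereal ` B)"
    using neg by (blast intro: Sup_ereal_image_nonneg)+
  have "Sup (ereal ` B) = inverse (Sup (ereal ` A))"
    using Sup_ereal_le_inverse_Sup_ereal[OF nonneg(1) mult_le]
      inverse_Sup_ereal_le_Sup_ereal[OF nonneg mem] by (rule antisym)
  then show ?thesis using product_one_inverse[OF nonneg(1)] by simp
qed

section \<open>Exponents\<close>

lemma has_independent_solutions_iff_le_dim:
  "has_independent_solutions k \<sigma> \<rho> \<Theta> \<gamma> t \<longleftrightarrow> k \<le> dim (approx_solutions \<sigma> \<rho> \<Theta> \<gamma> t)"
proof
  assume "has_independent_solutions k \<sigma> \<rho> \<Theta> \<gamma> t"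
  then show "k \<le> dim (approx_solutions \<sigma> \<rho> \<Theta> \<gamma> t)"
    unfolding has_independent_solutions_def using independent_card_le_dim by blast
next
  assume k_le: "k \<le> dim (approx_solutions \<sigma> \<rho> \<Theta> \<gamma> t)"
  obtain B where B_basis: "B \<subseteq> approx_solutions \<sigma> \<rho> \<Theta> \<gamma> t" "independent B"
    "card B = dim (approx_solutions \<sigma> \<rho> \<Theta> \<gamma> t)"
    by (rule basis_exists)
  with k_le obtain S where "S \<subseteq> B" "card S = k" "finite S" by (metis obtain_subset_with_card_n)
  then show "has_independent_solutions k \<sigma> \<rho> \<Theta> \<gamma> t"
    unfolding has_independent_solutions_def using B_basis(1,2) independent_mono by blast
qed

lemma eventually_dim_approx_solutions_ge:
  fixes \<Theta> :: "real ^ 'm ^ 'n"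
  assumes weights: "\<And>j. 0 < \<sigma> $ j" "\<And>i. 0 < \<rho> $ i" and "\<gamma> < g" "g * \<delta> < 1"
  shows "\<forall>\<^sub>F t in at_top. CARD('m) + CARD('n) \<le> dim (approx_solutions \<sigma> \<rho> \<Theta> \<gamma> t) +
    dim (approx_solutions \<rho> \<sigma> (transpose \<Theta>) \<delta> (t powr g))"
proof -
  define C :: real where "C = fact (CARD('m) + CARD('n) + 1)"
  have "\<forall>\<^sub>F t in at_top. \<forall>i. (C *\<^sub>R box_radii \<rho> (t powr \<gamma>)) $ i \<le> box_radii \<rho> (t powr g) $ i"
    using weights(2) \<open>\<gamma> < g\<close> by (rule eventually_scaleR_box_radii_le)
  moreover have "\<forall>\<^sub>F t in at_top. \<forall>j. (C *\<^sub>R box_radii \<sigma> (t powr - 1)) $ j \<le>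
      box_radii \<sigma> (t powr (- (g * \<delta>))) $ j"
    using weights(1) \<open>g * \<delta> < 1\<close> by (intro eventually_scaleR_box_radii_le) auto
  ultimately show ?thesis using eventually_gt_at_top[of 0]
  proof eventually_elim
    case (elim t)
    define a where "a = box_radii \<sigma> t"
    define q where "q = box_radii \<rho> (t powr - \<gamma>)"
    have pos: "0 < a $ j" "0 < q $ i" for i j
      using elim(3) by (simp_all add: a_def q_def box_radii_def)
    have "vec_inverse q = box_radii \<rho> (t powr \<gamma>)" "vec_inverse a = box_radii \<sigma> (t powr - 1)"
      using elim(3) by (simp_all add: a_def q_def vec_inverse_box_radii powr_minus)
    then have "box_solutions (C *\<^sub>R vec_inverse q) (C *\<^sub>R vec_inverse a) (transpose \<Theta>) \<subseteq>
        approx_solutions \<rho> \<sigma> (transpose \<Theta>) \<delta> (t powr g)"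
      using elim
      by (simp add: approx_solutions_eq_box_solutions weights powr_powr box_solutions_mono)
    from dim_subset[OF this] show ?case
      using dim_box_solutions_transference[OF pos, of \<Theta>]
        approx_solutions_eq_box_solutions[OF weights elim(3)]
      unfolding C_def a_def q_def by simp
  qed
qed

lemma eventually_dim_approx_solutions_le:
  fixes \<Theta> :: "real ^ 'm ^ 'n"
  assumes weights: "\<And>j. 0 < \<sigma> $ j" "\<And>i. 0 < \<rho> $ i" and "g < \<gamma>" "1 < g * \<delta>"
  shows "\<forall>\<^sub>F t in at_top. dim (approx_solutions \<sigma> \<rho> \<Theta> \<gamma> t) +
    dim (approx_solutions \<rho> \<sigma> (transpose \<Theta>) \<delta> (t powr g)) \<le> CARD('m) + CARD('n)"
proof -
  have "((\<lambda>t. box_radii \<sigma> (t powr 1) \<bullet> box_radii \<sigma> (t powr (- (g * \<delta>))) +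
      box_radii \<rho> (t powr - \<gamma>) \<bullet> box_radii \<rho> (t powr g)) \<longlongrightarrow> 0 + 0) at_top"
    using assms by (intro tendsto_add tendsto_inner_box_radii_0) auto
  then have "\<forall>\<^sub>F t in at_top. box_radii \<sigma> (t powr 1) \<bullet> box_radii \<sigma> (t powr (- (g * \<delta>))) +
      box_radii \<rho> (t powr - \<gamma>) \<bullet> box_radii \<rho> (t powr g) < 1"
    by (rule order_tendstoD) simp
  then show ?thesis using eventually_gt_at_top[of 0]
  proof eventually_elim
    case (elim t)
    then show ?case
      by (simp add: approx_solutions_eq_box_solutions weights powr_powr
          dim_box_solutions_obstruction)
  qed
qed

lemma eventually_subset_approx_solutions:
  assumes "finite S" "S \<subseteq> int_vectors \<times> int_vectors" "\<gamma> < 0"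
  shows "\<forall>\<^sub>F t in at_top. S \<subseteq> approx_solutions \<sigma> \<rho> \<Theta> \<gamma> t"
proof -
  have "\<forall>\<^sub>F t in at_top. \<forall>z\<in>S. weighted_norm \<sigma> (fst z) \<le> t"
    using assms(1) by (intro eventually_ball_finite ballI eventually_ge_at_top)
  moreover have "\<forall>\<^sub>F t in at_top. \<forall>z\<in>S. weighted_norm \<rho> (\<Theta> *v fst z - snd z) \<le> t powr - \<gamma>"
    using assms(1,3) by (intro eventually_ball_finite ballI eventually_le_powr) simp_all
  ultimately show ?thesis
    by eventually_elim (use assms(2) in \<open>force simp: approx_solutions_def\<close>)
qed

lemma eventually_has_independent_solutions_if_neg:
  fixes \<Theta> :: "real ^ 'm ^ 'n"
  assumes "k \<le> CARD('m) + CARD('n)" "\<gamma> < 0"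
  shows "\<forall>\<^sub>F t in at_top. has_independent_solutions k \<sigma> \<rho> \<Theta> \<gamma> t"
proof -
  have "\<forall>\<^sub>F t in at_top. Basis \<subseteq> approx_solutions \<sigma> \<rho> \<Theta> \<gamma> t"
    using finite_Basis Basis_subset_int_vectors_Times assms(2)
    by (rule eventually_subset_approx_solutions)
  then show ?thesis
  proof eventually_elim
    case (elim t)
    then have "CARD('m) + CARD('n) \<le> dim (approx_solutions \<sigma> \<rho> \<Theta> \<gamma> t)"
      using independent_card_le_dim[OF elim independent_Basis] by simp
    then show ?case using assms(1) by (simp add: has_independent_solutions_iff_le_dim)
  qed
qed

lemma mult_le_1_if_frequently_and_eventually_solutions:
  fixes \<Theta> :: "real ^ 'm ^ 'n"
  assumes weights: "\<And>j. 0 < \<sigma> $ j" "\<And>i. 0 < \<rho> $ i" and k_le: "k \<le> CARD('m) + CARD('n)"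
    and pos: "0 < \<gamma>" "0 < \<delta>"
    and freq: "\<exists>\<^sub>F t in at_top. has_independent_solutions k \<sigma> \<rho> \<Theta> \<gamma> t"
    and ev: "\<forall>\<^sub>F t in at_top.
      has_independent_solutions (CARD('m) + CARD('n) + 1 - k) \<rho> \<sigma> (transpose \<Theta>) \<delta> t"
  shows "\<gamma> * \<delta> \<le> 1"
proof (rule ccontr)
  assume "\<not> \<gamma> * \<delta> \<le> 1"
  then have "1 / \<delta> < \<gamma>" using pos by (simp add: field_simps)
  then obtain g where g_between: "1 / \<delta> < g" "g < \<gamma>" using dense by blast
  have "0 < g" using g_between(1) pos(2) by (meson divide_pos_pos less_trans zero_less_one)
  then have "\<forall>\<^sub>F t in at_top.
      has_independent_solutions (CARD('m) + CARD('n) + 1 - k) \<rho> \<sigma> (transpose \<Theta>) \<delta> (t powr g)"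
    using ev by (simp add: eventually_powr_at_top_iff)
  moreover have "1 < g * \<delta>" using g_between(1) pos(2) by (simp add: field_simps)
  note eventually_dim_approx_solutions_le[OF weights g_between(2) this, of \<Theta>]
  ultimately have "\<forall>\<^sub>F t in at_top. \<not> has_independent_solutions k \<sigma> \<rho> \<Theta> \<gamma> t"
    unfolding has_independent_solutions_iff_le_dim by eventually_elim (use k_le in linarith)
  with freq show False by (simp add: frequently_def)
qed

lemma frequently_or_eventually_solutions_if_mult_less_1:
  fixes \<Theta> :: "real ^ 'm ^ 'n"
  assumes weights: "\<And>j. 0 < \<sigma> $ j" "\<And>i. 0 < \<rho> $ i" and pos: "0 < \<gamma>" "0 < \<delta>" and "\<gamma> * \<delta> < 1"
  shows "(\<exists>\<^sub>F t in at_top. has_independent_solutions k \<sigma> \<rho> \<Theta> \<gamma> t) \<or>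
    (\<forall>\<^sub>F t in at_top.
      has_independent_solutions (CARD('m) + CARD('n) + 1 - k) \<rho> \<sigma> (transpose \<Theta>) \<delta> t)"
proof -
  have "\<gamma> < 1 / \<delta>" using assms(5) pos by (simp add: field_simps)
  then obtain g where g_between: "\<gamma> < g" "g < 1 / \<delta>" using dense by blast
  have "\<forall>\<^sub>F t in at_top.
      has_independent_solutions (CARD('m) + CARD('n) + 1 - k) \<rho> \<sigma> (transpose \<Theta>) \<delta> (t powr g)"
    if "\<forall>\<^sub>F t in at_top. \<not> has_independent_solutions k \<sigma> \<rho> \<Theta> \<gamma> t"
  proof -
    have "g * \<delta> < 1" using g_between(2) pos(2) by (simp add: field_simps)
    note eventually_dim_approx_solutions_ge[OF weights g_between(1) this, of \<Theta>]
    with that show ?thesis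
      unfolding has_independent_solutions_iff_le_dim by eventually_elim linarith
  qed
  moreover have "0 < g" using g_between(1) pos(1) by linarith
  ultimately show ?thesis unfolding frequently_def by (metis eventually_powr_at_top_iff)
qed

lemma product_one_omega_exp_omega_hat_exp:
  fixes \<Theta> :: "real ^ 'm ^ 'n"
  assumes weights: "\<And>j. 0 < \<sigma> $ j" "\<And>i. 0 < \<rho> $ i" and k_range: "1 \<le> k" "k \<le> CARD('m) + CARD('n)"
  shows "product_one (omega_exp k \<sigma> \<rho> \<Theta>)
    (omega_hat_exp (CARD('m) + CARD('n) + 1 - k) \<rho> \<sigma> (transpose \<Theta>))"
proof -
  define k' where "k' = CARD('m) + CARD('n) + 1 - k"
  define A where "A = {\<gamma>. \<exists>\<^sub>F t in at_top. has_independent_solutions k \<sigma> \<rho> \<Theta> \<gamma> t}"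
  define B where "B = {\<delta>. \<forall>\<^sub>F t in at_top. has_independent_solutions k' \<rho> \<sigma> (transpose \<Theta>) \<delta> t}"
  have "product_one (Sup (ereal ` A)) (Sup (ereal ` B))"
  proof (rule product_one_Sup)
    show "\<gamma> \<in> A" if "\<gamma> < 0" for \<gamma>
      using eventually_has_independent_solutions_if_neg[OF k_range(2) that]
      by (auto simp: A_def intro: eventually_frequently)
    show "\<delta> \<in> B" if "\<delta> < 0" for \<delta>
      using k_range that by (simp add: B_def k'_def eventually_has_independent_solutions_if_neg)
    show "\<gamma> * \<delta> \<le> 1" if "\<gamma> \<in> A" "\<delta> \<in> B" "0 < \<gamma>" "0 < \<delta>" for \<gamma> \<delta>
      using mult_le_1_if_frequently_and_eventually_solutions[OF weights k_range(2)] that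
      by (simp add: A_def B_def k'_def)
    show "\<gamma> \<in> A \<or> \<delta> \<in> B" if "0 < \<gamma>" "0 < \<delta>" "\<gamma> * \<delta> < 1" for \<gamma> \<delta>
      using frequently_or_eventually_solutions_if_mult_less_1[OF weights that]
      by (simp add: A_def B_def k'_def)
  qed
  then show ?thesis
    unfolding omega_exp_def omega_hat_exp_def A_def B_def k'_def by (simp add: image_Collect)
qed

theorem theorem5:
  fixes \<Theta> :: "real ^ 'm::{finite,linorder} ^ 'n::{finite,linorder}"
    and \<sigma> :: "real ^ 'm::{finite,linorder}" and \<rho> :: "real ^ 'n::{finite,linorder}" and k :: nat
  assumes "\<And>i j. i \<le> j \<Longrightarrow> \<sigma> $ j \<le> \<sigma> $ i" and "\<And>j. \<sigma> $ j > 0"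
    and "\<And>i j. i \<le> j \<Longrightarrow> \<rho> $ j \<le> \<rho> $ i" and "\<And>i. \<rho> $ i > 0"
    and "(\<Sum>j\<in>UNIV. \<sigma> $ j) = 1" and "(\<Sum>i\<in>UNIV. \<rho> $ i) = 1"
    and "1 \<le> k" and "k \<le> CARD('m) + CARD('n)"
  shows "product_one (omega_exp k \<sigma> \<rho> \<Theta>)
           (omega_hat_exp (CARD('m) + CARD('n) + 1 - k) \<rho> \<sigma> (transpose \<Theta>))
       \<and> product_one (omega_hat_exp k \<sigma> \<rho> \<Theta>)
           (omega_exp (CARD('m) + CARD('n) + 1 - k) \<rho> \<sigma> (transpose \<Theta>))"
proof
  show "product_one (omega_exp k \<sigma> \<rho> \<Theta>)
      (omega_hat_exp (CARD('m) + CARD('n) + 1 - k) \<rho> \<sigma> (transpose \<Theta>))"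
    using assms by (intro product_one_omega_exp_omega_hat_exp)
  define k' where "k' = CARD('m) + CARD('n) + 1 - k"
  have k'_range: "1 \<le> k'" "k' \<le> CARD('n) + CARD('m)" "CARD('n) + CARD('m) + 1 - k' = k"
    using assms(7,8) by (simp_all add: k'_def)
  have "product_one (omega_exp k' \<rho> \<sigma> (transpose \<Theta>)) (omega_hat_exp k \<sigma> \<rho> \<Theta>)"
    using product_one_omega_exp_omega_hat_exp[OF assms(4,2) k'_range(1,2), of "transpose \<Theta>"]
    unfolding k'_range(3) transpose_transpose .
  then show "product_one (omega_hat_exp k \<sigma> \<rho> \<Theta>)
      (omega_exp (CARD('m) + CARD('n) + 1 - k) \<rho> \<sigma> (transpose \<Theta>))"
    by (simp add: product_one_commute k'_def)
qed

end
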